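(* Let $T\subset\mathbb{R}^2$ be a triangle, let its split point be the incenter of $T$, and let $T^{ct}=\{K_1,K_2,K_3\}$ be the resulting Clough--Tocher split. If $T$ satisfies $LAC(\delta)$ for some $\delta>0$, then all triangles in $T^{ct}$ satisfy $LAC(\delta/2)$.
   Context: A (nondegenerate) triangle satisfies the large angle condition $LAC(\delta)$, $\delta>0$, if all its interior angles are strictly less than $\pi-\delta$. If $T$ has vertices $z_1,z_2,z_3$ and $h_i$ is the length of the edge opposite $z_i$, the incenter of $T$ is $\frac{1}{|\partial T|}(h_1z_1+h_2z_2+h_3z_3)$, where $|\partial T|=h_1+h_2+h_3$. The Clough--Tocher split of $T$ with respect to an interior split point $z_0$ is the set of three triangles obtained by connecting the vertices of $T$ to $z_0$. *)

theory Defs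
  imports "HOL-Analysis.Analysis"
begin

text \<open>Triangles are solid, closed and nondegenerate: convex hulls of three affinely independent
  points. Their vertices are recovered from the set as its extreme points.\<close>

abbreviation triangle :: "(real^2) set \<Rightarrow> bool" where
  "triangle T \<equiv> 2 simplex T"

definition vertices :: "(real^2) set \<Rightarrow> (real^2) set" where
  "vertices T = {z. z extreme_point_of T}"

text \<open>The unoriented angle at \<open>b\<close> between the rays towards \<open>a\<close> and \<open>c\<close>, in the range from 0 to
  \<open>pi\<close>. It is only meaningful when \<open>a\<close> and \<open>c\<close> differ from \<open>b\<close>.\<close>

definition angle_at :: "real^2 \<Rightarrow> real^2 \<Rightarrow> real^2 \<Rightarrow> real" where
  "angle_at a b c = arccos (((a - b) \<bullet> (c - b)) / (norm (a - b) * norm (c - b)))"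

definition LAC :: "real \<Rightarrow> (real^2) set \<Rightarrow> bool" where
  "LAC \<delta> T \<longleftrightarrow>
     triangle T \<and> (\<forall>a b c. vertices T = {a, b, c} \<longrightarrow> angle_at a b c < pi - \<delta>)"

text \<open>For a triangle, removing the vertex \<open>z\<close> leaves the two endpoints of the opposite edge, and
  the diameter of that two-point set is the length of the edge.\<close>

definition opposite_edge_length :: "(real^2) set \<Rightarrow> real^2 \<Rightarrow> real" where
  "opposite_edge_length T z = diameter (vertices T - {z})"

definition perimeter :: "(real^2) set \<Rightarrow> real" where
  "perimeter T = (\<Sum>z\<in>vertices T. opposite_edge_length T z)"

definition incenter :: "(real^2) set \<Rightarrow> real^2" where
  "incenter T = (1 / perimeter T) *\<^sub>R (\<Sum>z\<in>vertices T. opposite_edge_length T z *\<^sub>R z)"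

definition clough_tocher_split :: "(real^2) set \<Rightarrow> real^2 \<Rightarrow> (real^2) set set" where
  "clough_tocher_split T z0 =
     {convex hull {z0, a, b} | a b. a \<in> vertices T \<and> b \<in> vertices T \<and> a \<noteq> b}"

text \<open>The descriptions in terms of a labelling of the vertices.\<close>

lemma triangle_iff: "triangle T \<longleftrightarrow> (\<exists>a b c. \<not> collinear {a, b, c} \<and> T = convex hull {a, b, c})"
proof
  assume "triangle T"
  then obtain C where C: "\<not> affine_dependent C" "card C = 3" "T = convex hull C"
    by (auto simp: simplex_def)
  then obtain a b c where "C = {a, b, c}" "a \<noteq> b" "a \<noteq> c" "b \<noteq> c"
    by (auto simp: card_3_iff)
  with C show "\<exists>a b c. \<not> collinear {a, b, c} \<and> T = convex hull {a, b, c}"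
    using collinear_3_eq_affine_dependent by blast
next
  assume "\<exists>a b c. \<not> collinear {a, b, c} \<and> T = convex hull {a, b, c}"
  then obtain a b c where *: "\<not> collinear {a, b, c}" "T = convex hull {a, b, c}" by blast
  then have "a \<noteq> b" "a \<noteq> c" "b \<noteq> c" "\<not> affine_dependent {a, b, c}"
    by (auto simp: collinear_3_eq_affine_dependent)
  with * show "triangle T"
    unfolding simplex_def by (intro exI[of _ "{a, b, c}"]) simp
qed

lemma vertices_convex_hull:
  assumes "\<not> collinear {a, b, c}"
  shows "vertices (convex hull {a, b, c}) = {a, b, c}"
  using assms unfolding vertices_def collinear_3_eq_affine_dependent
  by (subst extreme_point_of_convex_hull_affine_independent) auto

lemma diameter_doubleton: "diameter {a, b :: real^2} = dist a b"
proof (rule antisym)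
  show "diameter {a, b} \<le> dist a b"
    by (rule diameter_le) (auto simp: dist_norm norm_minus_commute)
  show "dist a b \<le> diameter {a, b}"
    by (rule diameter_bounded_bound) auto
qed

lemma opposite_edge_length_convex_hull:
  assumes "\<not> collinear {a, b, c}"
  shows "opposite_edge_length (convex hull {a, b, c}) a = dist b c"
proof -
  have "a \<noteq> b" "a \<noteq> c"
    using assms by (auto simp: collinear_3_eq_affine_dependent)
  then have "{a, b, c} - {a} = {b, c}" by auto
  then show ?thesis
    using assms
    by (simp add: opposite_edge_length_def vertices_convex_hull diameter_doubleton)
qed

lemma incenter_convex_hull:
  assumes "\<not> collinear {z1, z2, z3}"
  shows "incenter (convex hull {z1, z2, z3}) =
    (1 / (dist z2 z3 + dist z1 z3 + dist z1 z2)) *\<^sub>R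
      (dist z2 z3 *\<^sub>R z1 + dist z1 z3 *\<^sub>R z2 + dist z1 z2 *\<^sub>R z3)"
proof -
  have eqs: "{z2, z1, z3} = {z1, z2, z3}" "{z3, z1, z2} = {z1, z2, z3}" by auto
  have "z1 \<noteq> z2" "z1 \<noteq> z3" "z2 \<noteq> z3"
    using assms by (auto simp: collinear_3_eq_affine_dependent)
  moreover note opposite_edge_length_convex_hull[of z1 z2 z3]
    opposite_edge_length_convex_hull[of z2 z1 z3, unfolded eqs]
    opposite_edge_length_convex_hull[of z3 z1 z2, unfolded eqs]
  ultimately show ?thesis
    using assms by (simp add: incenter_def perimeter_def vertices_convex_hull add.assoc)
qed

lemma incenter_in_interior:
  assumes "triangle T"
  shows "incenter T \<in> interior T"
proof -
  obtain a b c where *: "\<not> collinear {a, b, c}" "T = convex hull {a, b, c}"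
    using assms triangle_iff by blast
  define p where "p = dist b c + dist a c + dist a b"
  have "a \<noteq> b" "a \<noteq> c" "b \<noteq> c"
    using * by (auto simp: collinear_3_eq_affine_dependent)
  then have pos: "dist b c > 0" "dist a c > 0" "dist a b > 0" "p > 0"
    by (auto simp: p_def add_pos_pos)
  then have "dist b c / p + dist a c / p + dist a b / p = 1"
    by (simp add: add_divide_distrib[symmetric] flip: p_def)
  moreover have "(dist b c / p) *\<^sub>R a + (dist a c / p) *\<^sub>R b + (dist a b / p) *\<^sub>R c = incenter T"
    using * by (simp add: incenter_convex_hull p_def[symmetric] scaleR_add_right)
  moreover have "dist b c / p > 0" "dist a c / p > 0" "dist a b / p > 0"
    using pos by simp_all
  moreover have "interior T =
      {v. \<exists>x y z. 0 < x \<and> 0 < y \<and> 0 < z \<and> x + y + z = 1 \<and> x *\<^sub>R a + y *\<^sub>R b + z *\<^sub>R c = v}"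
    using * by (simp add: interior_convex_hull_3_minimal)
  ultimately show ?thesis by blast
qed

lemma clough_tocher_split_convex_hull:
  assumes "\<not> collinear {z1, z2, z3}"
  shows "clough_tocher_split (convex hull {z1, z2, z3}) z0 =
    {convex hull {z0, z2, z3}, convex hull {z0, z1, z3}, convex hull {z0, z1, z2}}"
proof -
  have "z1 \<noteq> z2" "z1 \<noteq> z3" "z2 \<noteq> z3"
    using assms by (auto simp: collinear_3_eq_affine_dependent)
  then show ?thesis
    using assms unfolding clough_tocher_split_def
    by (auto simp: vertices_convex_hull insert_commute) (metis insert_commute)+
qed

end

theory Submission
  imports Defs
begin

text \<open>Write \<open>\<alpha>\<close>, \<open>\<beta>\<close>, \<open>\<gamma>\<close> for the angles of the triangle \<open>abc\<close>. The incenter \<open>z\<close> lies on all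
  three angle bisectors (lemma \<open>angle_at_incenter\<close>), so the triangle \<open>zab\<close> has the angle
  \<open>\<alpha>/2\<close> at \<open>a\<close> and \<open>\<beta>/2\<close> at \<open>b\<close>. Since angles of a triangle add up to \<open>\<pi>\<close> (lemma
  \<open>triangle_angle_sum\<close>), applied once to \<open>zab\<close> and once to \<open>abc\<close>, its angle at \<open>z\<close> is
  \<open>\<pi> - (\<alpha> + \<beta>)/2 = \<pi>/2 + \<gamma>/2\<close>. The hypothesis \<open>\<gamma> < \<pi> - \<delta>\<close> makes this less than
  \<open>\<pi> - \<delta>/2\<close>, which is why exactly half of \<open>\<delta>\<close> survives; the two halved angles are below
  \<open>\<pi>/2 - \<delta>/2\<close>. The other two triangles of the split follow by relabelling the vertices.\<close>

section \<open>Angles of a triangle\<close>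

lemma angle_at_commute: "angle_at a b c = angle_at c b a"
  by (simp add: angle_at_def inner_commute mult.commute)

lemma cosine_bounded: "\<bar>((u::real^2) \<bullet> v) / (norm u * norm v)\<bar> \<le> 1"
  using Cauchy_Schwarz_ineq2[of u v] by (auto simp: abs_mult divide_le_eq_1)

lemma cos_angle_at: "cos (angle_at a b c) = ((a - b) \<bullet> (c - b)) / (norm (a - b) * norm (c - b))"
  unfolding angle_at_def using cosine_bounded[of "a - b" "c - b"] by (simp add: cos_arccos_abs)

lemma angle_at_nonneg: "0 \<le> angle_at a b c"
  unfolding angle_at_def using cosine_bounded[of "a - b" "c - b"] by (simp only: arccos_lbound abs_le_iff minus_le_iff)

lemma angle_at_le_pi: "angle_at a b c \<le> pi"
  unfolding angle_at_def using cosine_bounded[of "a - b" "c - b"] by (simp only: arccos_ubound abs_le_iff minus_le_iff)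

lemma sin_angle_at:
  assumes "a \<noteq> b" "c \<noteq> b"
  shows "sin (angle_at a b c) =
    sqrt (((a - b) \<bullet> (a - b)) * ((c - b) \<bullet> (c - b)) - ((a - b) \<bullet> (c - b))\<^sup>2) /
      (norm (a - b) * norm (c - b))"
proof -
  have n: "norm (a - b) * norm (c - b) > 0" using assms by simp
  have "sin (angle_at a b c) = sqrt (1 - (cos (angle_at a b c))\<^sup>2)"
    using sin_ge_zero[OF angle_at_nonneg angle_at_le_pi] by (simp add: cos_squared_eq)
  also have "1 - (cos (angle_at a b c))\<^sup>2 =
     (((a - b) \<bullet> (a - b)) * ((c - b) \<bullet> (c - b)) - ((a - b) \<bullet> (c - b))\<^sup>2) /
      (norm (a - b) * norm (c - b))\<^sup>2"
    using assms
    by (simp add: cos_angle_at power_divide diff_divide_distrib power_mult_distrib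
        power2_norm_eq_inner)
  finally show ?thesis using n by (simp add: real_sqrt_divide)
qed

text \<open>An angle equal to \<open>\<pi>\<close> would be the equality case of the Cauchy-Schwarz inequality.\<close>

lemma angle_at_less_pi:
  assumes "\<not> collinear {a, b, c}"
  shows "angle_at a b c < pi"
proof (rule ccontr)
  assume "\<not> angle_at a b c < pi"
  then have "angle_at a b c = pi" using angle_at_le_pi[of a b c] by linarith
  then have eq: "(a - b) \<bullet> (c - b) / (norm (a - b) * norm (c - b)) = -1"
    using cos_angle_at[of a b c] by simp
  moreover have "norm (a - b) * norm (c - b) \<noteq> 0" using eq by auto
  ultimately have "\<bar>(a - b) \<bullet> (c - b)\<bar> = norm (a - b) * norm (c - b)"
    by (simp add: divide_eq_eq)
  then have "collinear {0, a - b, c - b}" by (simp add: norm_cauchy_schwarz_equal)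
  then show False using assms collinear_3[of a b c] by simp
qed

text \<open>The sine of each angle is \<open>s\<close> divided by the lengths of the two adjacent edges, where \<open>s\<close>
  is twice the area of the triangle. The addition theorems then give
  \<open>cos (\<alpha> + \<beta>) = - cos \<gamma>\<close> and \<open>sin (\<alpha> + \<beta>) = sin \<gamma>\<close>, hence
  \<open>cos (\<alpha> + \<beta> + \<gamma>) = -1\<close>; as \<open>0 \<le> \<alpha> + \<beta> + \<gamma> < 3\<pi>\<close>, this forces
  \<open>\<alpha> + \<beta> + \<gamma> = \<pi>\<close>.\<close>

lemma triangle_angle_sum:
  assumes nc: "\<not> collinear {a, b, c}"
  shows "angle_at b a c + angle_at a b c + angle_at a c b = pi"
proof -
  have ne: "a \<noteq> b" "a \<noteq> c" "b \<noteq> c"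
    using nc by (auto simp: collinear_3_eq_affine_dependent)
  define u where "u = b - a"
  define v where "v = c - a"
  define p where "p = u \<bullet> u"
  define q where "q = v \<bullet> v"
  define r where "r = u \<bullet> v"
  define s where "s = sqrt (p * q - r\<^sup>2)"
  define A where "A = norm (b - c)"
  define B where "B = norm v"
  define C where "C = norm u"
  have pos: "A > 0" "B > 0" "C > 0"
    using ne by (auto simp: A_def B_def C_def u_def v_def)
  have CC: "C * C = p"
    by (simp add: C_def p_def norm_eq_sqrt_inner)
  have ss: "s * s = p * q - r * r"
    using Cauchy_Schwarz_ineq[of u v] by (simp add: s_def p_def q_def r_def power2_eq_square)
  \<comment> \<open>All edges are expressed through the two that start at \<open>a\<close>.\<close>
  have edges: "a - b = - u" "c - b = v - u" "a - c = - v" "b - c = u - v" "b - a = u" "c - a = v"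
    by (simp_all add: u_def v_def)
  have norms: "norm (v - u) = A" "norm (u - v) = A" "norm u = C" "norm v = B"
    by (simp_all add: A_def B_def C_def u_def v_def norm_minus_commute)
  have dots: "u \<bullet> v = r" "(- u) \<bullet> (v - u) = p - r" "(- v) \<bullet> (u - v) = q - r"
      "(v - u) \<bullet> (v - u) = p + q - 2 * r" "(u - v) \<bullet> (u - v) = p + q - 2 * r"
      "u \<bullet> u = p" "v \<bullet> v = q" "(- u) \<bullet> (- u) = p" "(- v) \<bullet> (- v) = q"
    by (simp_all add: p_def q_def r_def algebra_simps inner_commute)
  have cosines: "cos (angle_at b a c) = r / (C * B)"
      "cos (angle_at a b c) = (p - r) / (C * A)"
      "cos (angle_at a c b) = (q - r) / (B * A)"
    unfolding cos_angle_at edges dots by (simp_all only: norms norm_minus_cancel)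
  have areas: "sqrt (p * (p + q - 2 * r) - (p - r)\<^sup>2) = s" "sqrt (q * (p + q - 2 * r) - (q - r)\<^sup>2) = s"
    by (simp_all add: s_def algebra_simps power2_eq_square)
  have sines: "sin (angle_at b a c) = s / (C * B)"
      "sin (angle_at a b c) = s / (C * A)"
      "sin (angle_at a c b) = s / (B * A)"
    using sin_angle_at[of b a c] sin_angle_at[of a b c] sin_angle_at[of a c b] ne
    unfolding edges dots areas s_def[symmetric]
    by (simp_all only: norms norm_minus_cancel not_sym simp_thms)
  let ?x = "angle_at b a c + angle_at a b c"
  have "cos ?x = (r * (p - r) - s * s) / (C * C * (B * A))"
    using pos by (simp add: cos_add cosines sines field_simps)
  also have "r * (p - r) - s * s = - (C * C) * (q - r)"
    unfolding ss CC by (simp add: algebra_simps)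
  also have "- (C * C) * (q - r) / (C * C * (B * A)) = - cos (angle_at a c b)"
    using pos by (simp add: cosines field_simps)
  finally have c: "cos ?x = - cos (angle_at a c b)" .
  have "sin ?x = (C * C) * s / (C * C * (B * A))"
    using pos unfolding CC by (simp add: sin_add cosines sines CC[symmetric] field_simps)
  then have s: "sin ?x = sin (angle_at a c b)"
    using pos by (simp add: sines)
  have "cos (?x + angle_at a c b) = -1"
    using sin_cos_squared_add3[of "angle_at a c b"] unfolding cos_add[of ?x] c s by linarith
  then have "cos (?x + angle_at a c b - pi) = 1"
    by (simp only: cos_diff) simp
  then obtain k :: int where k: "?x + angle_at a c b - pi = of_int k * 2 * pi"
    using cos_one_2pi_int by blast
  have "angle_at b a c < pi" "angle_at a b c < pi" "angle_at a c b < pi"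
    using angle_at_less_pi[of b a c] angle_at_less_pi[of a b c] angle_at_less_pi[of a c b] nc
    by (auto simp: insert_commute)
  then have "of_int k * (2 * pi) < 1 * (2 * pi)" "(-1) * (2 * pi) < of_int k * (2 * pi)"
    using k angle_at_nonneg[of b a c] angle_at_nonneg[of a b c] angle_at_nonneg[of a c b]
      pi_gt_zero by linarith+
  then have "real_of_int k < 1" "-1 < real_of_int k"
    by (simp_all only: mult_less_cancel_right_pos pi_gt_zero zero_less_mult_iff zero_less_numeral
        simp_thms mult_less_cancel_right) auto
  then have "k = 0" by linarith
  then show ?thesis using k by simp
qed

lemma LAC_convex_hull:
  assumes "\<not> collinear {a, b, c}"
  shows "LAC \<delta> (convex hull {a, b, c}) \<longleftrightarrow>
    angle_at b a c < pi - \<delta> \<and> angle_at a b c < pi - \<delta> \<and> angle_at a c b < pi - \<delta>"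
    (is "_ \<longleftrightarrow> ?angles")
proof
  assume "LAC \<delta> (convex hull {a, b, c})"
  then have *: "\<And>x y z. {a, b, c} = {x, y, z} \<Longrightarrow> angle_at x y z < pi - \<delta>"
    using assms by (simp add: LAC_def vertices_convex_hull)
  show ?angles by (intro conjI *) auto
next
  assume angles: ?angles
  have ne: "a \<noteq> b" "a \<noteq> c" "b \<noteq> c"
    using assms by (auto simp: collinear_3_eq_affine_dependent)
  have "angle_at x y z < pi - \<delta>" if "{a, b, c} = {x, y, z}" for x y z
  proof -
    have "(y = a \<and> {x, z} = {b, c}) \<or> (y = b \<and> {x, z} = {a, c}) \<or> (y = c \<and> {x, z} = {a, b})"
      using that ne by (smt (verit) insert_iff empty_iff insertE doubleton_eq_iff)
    then show ?thesis
      using angles by (auto simp: doubleton_eq_iff angle_at_commute)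
  qed
  then show "LAC \<delta> (convex hull {a, b, c})"
    using assms triangle_iff by (auto simp: LAC_def vertices_convex_hull)
qed

section \<open>The incenter and the angle bisectors\<close>

text \<open>Weighting the vertices by the opposite edge lengths makes \<open>z - a\<close> a positive multiple of
  \<open>e + f\<close>, where \<open>e\<close> and \<open>f\<close> are the unit vectors along the two edges at \<open>a\<close>. Hence the
  cosine of the angle between \<open>z - a\<close> and \<open>e\<close> is \<open>sqrt ((1 + e \<bullet> f) / 2)\<close>, the half-angle
  formula for \<open>e \<bullet> f = cos \<alpha>\<close>.\<close>

lemma angle_at_incenter:
  assumes nc: "\<not> collinear {a, b, c}"
  shows "angle_at (incenter (convex hull {a, b, c})) a b = angle_at b a c / 2"
proof -
  have ne: "a \<noteq> b" "a \<noteq> c" "b \<noteq> c"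
    using nc by (auto simp: collinear_3_eq_affine_dependent)
  define z where "z = incenter (convex hull {a, b, c})"
  define p where "p = dist b c + dist a c + dist a b"
  define m where "m = dist a c * dist a b / p"
  define e where "e = (b - a) /\<^sub>R dist a b"
  define f where "f = (c - a) /\<^sub>R dist a c"
  define \<alpha> where "\<alpha> = angle_at b a c"
  have "p > 0" using ne by (simp add: p_def add_pos_pos)
  then have "m > 0" using ne by (simp add: m_def)
  have "p *\<^sub>R (z - a) = dist a c *\<^sub>R (b - a) + dist a b *\<^sub>R (c - a)"
    using \<open>p > 0\<close> incenter_convex_hull[OF nc]
    by (simp add: z_def[symmetric] p_def[symmetric] scaleR_diff_right)
       (simp add: p_def algebra_simps)
  also have "\<dots> = p *\<^sub>R (m *\<^sub>R (e + f))"
    using ne \<open>p > 0\<close> by (simp add: m_def e_def f_def scaleR_add_right field_simps)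
  finally have z: "z - a = m *\<^sub>R (e + f)"
    using \<open>p > 0\<close> by (simp del: scaleR_scaleR)
  have b: "b - a = dist a b *\<^sub>R e" using ne by (simp add: e_def)
  have "norm e = 1" "norm f = 1"
    using ne by (simp_all add: e_def f_def dist_norm norm_minus_commute)
  then have ee: "e \<bullet> e = 1" and ff: "f \<bullet> f = 1" by (simp_all add: dot_square_norm)
  have ef: "e \<bullet> f = cos \<alpha>"
    by (simp add: \<alpha>_def cos_angle_at e_def f_def dist_norm norm_minus_commute divide_inverse)
  have \<alpha>: "0 \<le> \<alpha>" "\<alpha> < pi"
    using angle_at_nonneg angle_at_less_pi[of b a c] nc by (auto simp: \<alpha>_def insert_commute)
  then have half_pos: "0 < cos (\<alpha> / 2)" by (intro cos_gt_zero_pi) auto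
  have double: "1 + cos \<alpha> = 2 * (cos (\<alpha> / 2))\<^sup>2"
    using cos_double_cos[of "\<alpha> / 2"] by simp
  have "(norm (e + f))\<^sup>2 = (2 * cos (\<alpha> / 2))\<^sup>2"
    using ee ff ef double
    by (simp add: power2_norm_eq_inner inner_add inner_commute power_mult_distrib)
  then have norm_sum: "norm (e + f) = 2 * cos (\<alpha> / 2)"
    by (rule power2_eq_imp_eq) (use half_pos in auto)
  have "(z - a) \<bullet> (b - a) = m * dist a b * (1 + cos \<alpha>)"
    unfolding z b by (simp add: inner_add ee ef inner_commute)
  moreover have "norm (z - a) * norm (b - a) = m * dist a b * (2 * cos (\<alpha> / 2))"
    unfolding z b using \<open>m > 0\<close> \<open>norm e = 1\<close> by (simp add: norm_sum)
  ultimately have "(z - a) \<bullet> (b - a) / (norm (z - a) * norm (b - a)) = cos (\<alpha> / 2)"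
    using \<open>m > 0\<close> ne half_pos by (simp add: double power2_eq_square)
  then show ?thesis
    using \<alpha> by (simp add: angle_at_def[of z] z_def[symmetric] \<alpha>_def[symmetric] arccos_cos)
qed

text \<open>The vertex \<open>c\<close> enters the incenter with a nonzero weight, so if the incenter were on the
  line through \<open>a\<close> and \<open>b\<close>, then \<open>c\<close> would be on it as well.\<close>

lemma incenter_not_collinear:
  assumes nc: "\<not> collinear {a, b, c}"
  shows "\<not> collinear {incenter (convex hull {a, b, c}), a, b}"
proof
  define z where "z = incenter (convex hull {a, b, c})"
  define p where "p = dist b c + dist a c + dist a b"
  assume "collinear {incenter (convex hull {a, b, c}), a, b}"
  then have "collinear {a, z, b}" by (simp add: z_def insert_commute)
  moreover have ne: "a \<noteq> b" "a \<noteq> c" "b \<noteq> c"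
    using nc by (auto simp: collinear_3_eq_affine_dependent)
  ultimately obtain t where t: "z = t *\<^sub>R a + (1 - t) *\<^sub>R b"
    unfolding collinear_3_expand by auto
  have "p > 0" using ne by (simp add: p_def add_pos_pos)
  then have "p *\<^sub>R z = dist b c *\<^sub>R a + dist a c *\<^sub>R b + dist a b *\<^sub>R c"
    using incenter_convex_hull[OF nc] by (simp add: z_def p_def[symmetric])
  then have "dist a b *\<^sub>R c = (p * t - dist b c) *\<^sub>R a + (p * (1 - t) - dist a c) *\<^sub>R b"
    unfolding t by (simp add: algebra_simps)
  also have "p * (1 - t) - dist a c = dist a b - (p * t - dist b c)"
    by (simp add: p_def algebra_simps)
  finally have c: "dist a b *\<^sub>R c =
      (p * t - dist b c) *\<^sub>R a + (dist a b - (p * t - dist b c)) *\<^sub>R b" .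
  define k where "k = (p * t - dist b c) / dist a b"
  have "dist a b *\<^sub>R c = dist a b *\<^sub>R (k *\<^sub>R a + (1 - k) *\<^sub>R b)"
    unfolding c using ne
    by (simp only: k_def scaleR_add_right scaleR_scaleR right_diff_distrib) simp
  then have "c = k *\<^sub>R a + (1 - k) *\<^sub>R b" using ne by simp
  then have "collinear {a, c, b}" unfolding collinear_3_expand by blast
  then show False using nc by (simp add: insert_commute)
qed

lemma LAC_incenter_subtriangle:
  assumes nc: "\<not> collinear {a, b, c}" and "\<delta> > 0" and LAC: "LAC \<delta> (convex hull {a, b, c})"
  shows "LAC (\<delta> / 2) (convex hull {incenter (convex hull {a, b, c}), a, b})"
proof -
  define z where "z = incenter (convex hull {a, b, c})"
  have nz: "\<not> collinear {z, a, b}"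
    unfolding z_def by (rule incenter_not_collinear[OF nc])
  have at_a: "angle_at z a b = angle_at b a c / 2"
    unfolding z_def by (rule angle_at_incenter[OF nc])
  have "angle_at (incenter (convex hull {b, a, c})) b a = angle_at a b c / 2"
    using nc by (intro angle_at_incenter) (simp add: insert_commute)
  then have at_b: "angle_at z b a = angle_at a b c / 2"
    by (simp add: z_def insert_commute)
  show ?thesis
    using LAC \<open>\<delta> > 0\<close> triangle_angle_sum[OF nz] triangle_angle_sum[OF nc]
      angle_at_nonneg[of b a c] angle_at_nonneg[of a b c]
    by (simp add: LAC_convex_hull[OF nc] LAC_convex_hull[OF nz] at_a at_b angle_at_commute[of a z b]
        flip: z_def)
qed

theorem lemma2p5:
  fixes T :: "(real^2) set" and \<delta> :: real
  assumes "triangle T"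
    and "\<delta> > 0"
    and "LAC \<delta> T"
  shows "\<forall>K \<in> clough_tocher_split T (incenter T). LAC (\<delta> / 2) K"
proof -
  obtain a b c where nc: "\<not> collinear {a, b, c}" and T: "T = convex hull {a, b, c}"
    using assms(1) triangle_iff by blast
  have perms: "{b, c, a} = {a, b, c}" "{a, c, b} = {a, b, c}" by auto
  show ?thesis
    using LAC_incenter_subtriangle[of a b c \<delta>] LAC_incenter_subtriangle[of b c a \<delta>]
      LAC_incenter_subtriangle[of a c b \<delta>] nc assms(2,3)
    unfolding T clough_tocher_split_convex_hull[OF nc] perms by simp
qed

end
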